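(* Let $\mathcal{S}_{\min}$ be any minimal description of the restricted value function $z$. For $\zeta\in\mathcal{C}$ and $d\in\mathbb{R}^\ell$, $$\nabla_dz(\zeta)=\min_{x_I\in\mathcal{S}_I^*(\zeta)\cap\mathcal{S}_{\min}}\nabla_d\bar z(\zeta;x_I)=\begin{cases}\displaystyle\min_{x_I\in\mathcal{S}_I^*(\zeta)\cap\mathcal{S}_{\min}}\Big(\max_{u\in\mathcal{D}(\zeta;x_I)}u^\top d\Big),&\text{if } d\notin\bigcap_{x_I\in\mathcal{S}_I^*(\zeta)\cap\mathcal{S}_{\min}}\delta^-(\zeta;x_I),\\ +\infty,&\text{otherwise.}\end{cases}$$
   Context: Data: $A\in\mathbb{Q}^{m\times n}$, $b\in\mathbb{Q}^m$, and $C\in\mathbb{Q}^{(\ell+1)\times n}$ with rows $c^0,c^1,\dots,c^\ell$; $C^{1:\ell}$ is the submatrix of $C$ with rows $c^1,\dots,c^\ell$. The first $r$ variables are integer and the last $n-r$ are continuous; a subscript $I$ (resp. $C$) on a matrix or row vector denotes its columns corresponding to the integer (resp. continuous) variables. $X_{\rm MO}=\{(x_I,x_C)\in\mathbb{Z}_+^r\times\mathbb{R}_+^{n-r}: A_Ix_I+A_Cx_C=b\}$ is assumed bounded. For $\zeta\in\mathbb{R}^\ell$ let $\mathcal{S}(\zeta)=\{(x_I,x_C)\in X_{\rm MO}: C_I^{1:\ell}x_I+C_C^{1:\ell}x_C\le\zeta\}$, $\mathcal{C}=\{\zeta:\mathcal{S}(\zeta)\ne\emptyset\}$, $z(\zeta)=\inf_{(x_I,x_C)\in\mathcal{S}(\zeta)}c^0_Ix_I+c^0_Cx_C$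 ($+\infty$ for $\zeta\notin\mathcal{C}$). Let $\mathcal{S}_I(\zeta)=\{x_I:\exists x_C,(x_I,x_C)\in\mathcal{S}(\zeta)\}$ and $\mathcal{S}_I=\bigcup_{\zeta\in\mathcal{C}}\mathcal{S}_I(\zeta)$. Let $z_{\rm LP}(\zeta;\beta)=\inf\{c^0_Cx_C: C_C^{1:\ell}x_C\le\zeta,\ A_Cx_C=\beta,\ x_C\in\mathbb{R}_+^{n-r}\}$ ($+\infty$ if infeasible) and $\bar z(\zeta;x_I)=c^0_Ix_I+z_{\rm LP}(\zeta-C_I^{1:\ell}x_I;\ b-A_Ix_I)$ for $x_I\in\mathcal{S}_I$. Let $\mathcal{S}_I^*(\zeta)=\{x_I\in\mathcal{S}_I(\zeta):\bar z(\zeta;x_I)=z(\zeta)\}$. A description of $z$ is a set $\mathcal{S}\subseteq\mathcal{S}_I$ such that for every $\zeta\in\mathcal{C}$ there are $x_I\in\mathcal{S}$, $x_C\in\mathbb{R}^{n-r}_+$ with $(x_I,x_C)\in\mathcal{S}(\zeta)$ and $c^0_Ix_I+c^0_Cx_C=z(\zeta)$. It is minimal if no proper subset is a description. Let $\mathcal{P}_D=\{(u,v)\in\mathbb{R}^\ell_-\times\mathbb{R}^m:(C_C^{1:\ell})^\top u+A_C^\top v\le c^0_C\}$ and let $\mathcal{R}$ be its set of extreme rays, i.e. a finite set of generators of its recession cone $\{(e,h)\in\mathbb{R}^\ell_-\times\mathbb{R}^m:(C_C^{1:\ell})^\top e+A_C^\top h\le0\}$. For $x_I\in\mathcal{S}_I$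 let $\mathcal{D}(\zeta;x_I)=\{u:\exists v,\ (u,v)\in\mathcal{P}_D,\ (\zeta-C_I^{1:\ell}x_I)^\top u+(b-A_Ix_I)^\top v=z_{\rm LP}(\zeta-C_I^{1:\ell}x_I;b-A_Ix_I)\}$ (the projection onto $u$ of the optimal face of the dual LP), and let $\delta^-(\zeta;x_I)$ be the set of all $d\in\mathbb{R}^\ell\setminus\{\mathbf 0\}$ for which there is $(e,h)\in\mathcal{R}$ with $(\zeta-C_I^{1:\ell}x_I)^\top e+(b-A_Ix_I)^\top h=0$ and $d^\top e>0$. Directional derivatives are $\nabla_df(\zeta)=\lim_{t\searrow0}(f(\zeta+td)-f(\zeta))/t$, with value $+\infty$ allowed (at discontinuities or when $f(\zeta+td)=+\infty$ for small $t>0$); $\max_{u\in\mathcal{D}(\zeta;x_I)}u^\top d$ is taken to be $+\infty$ when unbounded. *)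

theory Defs
  imports "HOL-Analysis.Analysis"
begin

text \<open>
  The integer variables are given by a set \<open>ints\<close> of column indices and the continuous
  variables by its complement; either may be empty. The matrix of objectives is split
  into its row \<open>c0\<close> and the matrix \<open>Cm\<close> of its remaining rows.
\<close>

record ('n::finite, 'm::finite, 'l::finite) momilp =
  ints :: "'n set"
  Am :: "real^'n^'m"
  bv :: "real^'m"
  c0 :: "real^'n"
  Cm :: "real^'n^'l"

definition rational_data :: "('n::finite, 'm::finite, 'l::finite) momilp \<Rightarrow> bool" where
  "rational_data P \<longleftrightarrow>
     (\<forall>i j. Am P $ i $ j \<in> \<rat>) \<and> (\<forall>i. bv P $ i \<in> \<rat>) \<and>
     (\<forall>j. c0 P $ j \<in> \<rat>) \<and> (\<forall>i j. Cm P $ i $ j \<in> \<rat>)"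

text \<open>
  The integer part \<open>xI\<close> and the continuous part \<open>xC\<close> of a point are vectors over all columns
  that vanish outside their own block. Hence \<open>Am P *v xI\<close> is the product of the
  integer columns with the integer part, and so on for the other block products.
\<close>

definition int_part :: "('n::finite, 'm::finite, 'l::finite) momilp \<Rightarrow> (real^'n) set" where
  "int_part P = {x. (\<forall>j\<in>ints P. x $ j \<in> \<nat>) \<and> (\<forall>j. j \<notin> ints P \<longrightarrow> x $ j = 0)}"

definition cont_part :: "('n::finite, 'm::finite, 'l::finite) momilp \<Rightarrow> (real^'n) set" where
  "cont_part P = {x. (\<forall>j. j \<notin> ints P \<longrightarrow> 0 \<le> x $ j) \<and> (\<forall>j\<in>ints P. x $ j = 0)}"

definition X_MO :: "('n::finite, 'm::finite, 'l::finite) momilp \<Rightarrow> ((real^'n) \<times> (real^'n)) set" where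
  "X_MO P = {(xI, xC). xI \<in> int_part P \<and> xC \<in> cont_part P \<and>
                       Am P *v xI + Am P *v xC = bv P}"

definition feas :: "('n::finite, 'm::finite, 'l::finite) momilp \<Rightarrow> real^'l \<Rightarrow> ((real^'n) \<times> (real^'n)) set" where
  "feas P \<zeta> = {(xI, xC). (xI, xC) \<in> X_MO P \<and> Cm P *v xI + Cm P *v xC \<le> \<zeta>}"

definition feas_rhs :: "('n::finite, 'm::finite, 'l::finite) momilp \<Rightarrow> (real^'l) set" where
  "feas_rhs P = {\<zeta>. feas P \<zeta> \<noteq> {}}"

text \<open>Infima are taken in \<^typ>\<open>ereal\<close>, so that they are \<open>\<infinity>\<close> over the empty set.\<close>

definition rvf :: "('n::finite, 'm::finite, 'l::finite) momilp \<Rightarrow> real^'l \<Rightarrow> ereal" where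
  "rvf P \<zeta> = (INF (xI, xC) \<in> feas P \<zeta>. ereal (c0 P \<bullet> xI + c0 P \<bullet> xC))"

definition SI_at :: "('n::finite, 'm::finite, 'l::finite) momilp \<Rightarrow> real^'l \<Rightarrow> (real^'n) set" where
  "SI_at P \<zeta> = {xI. \<exists>xC. (xI, xC) \<in> feas P \<zeta>}"

definition SI :: "('n::finite, 'm::finite, 'l::finite) momilp \<Rightarrow> (real^'n) set" where
  "SI P = (\<Union>\<zeta>\<in>feas_rhs P. SI_at P \<zeta>)"

definition z_LP :: "('n::finite, 'm::finite, 'l::finite) momilp \<Rightarrow> real^'l \<Rightarrow> real^'m \<Rightarrow> ereal" where
  "z_LP P \<zeta> \<beta> =
     (INF xC \<in> {xC \<in> cont_part P. Cm P *v xC \<le> \<zeta> \<and> Am P *v xC = \<beta>}. ereal (c0 P \<bullet> xC))"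

definition zbar :: "('n::finite, 'm::finite, 'l::finite) momilp \<Rightarrow> real^'n \<Rightarrow> real^'l \<Rightarrow> ereal" where
  "zbar P xI \<zeta> = ereal (c0 P \<bullet> xI) + z_LP P (\<zeta> - Cm P *v xI) (bv P - Am P *v xI)"

definition SI_opt :: "('n::finite, 'm::finite, 'l::finite) momilp \<Rightarrow> real^'l \<Rightarrow> (real^'n) set" where
  "SI_opt P \<zeta> = {xI \<in> SI_at P \<zeta>. zbar P xI \<zeta> = rvf P \<zeta>}"

definition is_description :: "('n::finite, 'm::finite, 'l::finite) momilp \<Rightarrow> (real^'n) set \<Rightarrow> bool" where
  "is_description P S \<longleftrightarrow> S \<subseteq> SI P \<and>
     (\<forall>\<zeta>\<in>feas_rhs P. \<exists>xI\<in>S. \<exists>xC\<in>cont_part P.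
        (xI, xC) \<in> feas P \<zeta> \<and> ereal (c0 P \<bullet> xI + c0 P \<bullet> xC) = rvf P \<zeta>)"

definition is_minimal_description :: "('n::finite, 'm::finite, 'l::finite) momilp \<Rightarrow> (real^'n) set \<Rightarrow> bool" where
  "is_minimal_description P S \<longleftrightarrow>
     is_description P S \<and> (\<forall>T. T \<subset> S \<longrightarrow> \<not> is_description P T)"

text \<open>The dual constraints range over the continuous columns only.\<close>

definition dual_feas :: "('n::finite, 'm::finite, 'l::finite) momilp \<Rightarrow> ((real^'l) \<times> (real^'m)) set" where
  "dual_feas P = {(u, v). u \<le> 0 \<and>
     (\<forall>j. j \<notin> ints P \<longrightarrow> (transpose (Cm P) *v u + transpose (Am P) *v v) $ j \<le> c0 P $ j)}"

definition dual_rec_cone :: "('n::finite, 'm::finite, 'l::finite) momilp \<Rightarrow> ((real^'l) \<times> (real^'m)) set" where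
  "dual_rec_cone P = {(e, h). e \<le> 0 \<and>
     (\<forall>j. j \<notin> ints P \<longrightarrow> (transpose (Cm P) *v e + transpose (Am P) *v h) $ j \<le> 0)}"

text \<open>
  The cone need not be pointed, so \<open>R\<close> is any finite set of generators of it rather than
  a set of extreme rays in the strict sense.
\<close>

definition ray_generators :: "('n::finite, 'm::finite, 'l::finite) momilp \<Rightarrow> ((real^'l) \<times> (real^'m)) set \<Rightarrow> bool" where
  "ray_generators P R \<longleftrightarrow> finite R \<and> convex_cone hull R = dual_rec_cone P"

definition dual_opt :: "('n::finite, 'm::finite, 'l::finite) momilp \<Rightarrow> real^'n \<Rightarrow> real^'l \<Rightarrow> (real^'l) set" where
  "dual_opt P xI \<zeta> = {u. \<exists>v. (u, v) \<in> dual_feas P \<and>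
     ereal ((\<zeta> - Cm P *v xI) \<bullet> u + (bv P - Am P *v xI) \<bullet> v) =
       z_LP P (\<zeta> - Cm P *v xI) (bv P - Am P *v xI)}"

definition delta_minus ::
  "('n::finite, 'm::finite, 'l::finite) momilp \<Rightarrow> ((real^'l) \<times> (real^'m)) set \<Rightarrow> real^'n \<Rightarrow> real^'l \<Rightarrow> (real^'l) set" where
  "delta_minus P R xI \<zeta> = {d. d \<noteq> 0 \<and>
     (\<exists>(e, h)\<in>R. (\<zeta> - Cm P *v xI) \<bullet> e + (bv P - Am P *v xI) \<bullet> h = 0 \<and> d \<bullet> e > 0)}"

definition dual_max :: "('n::finite, 'm::finite, 'l::finite) momilp \<Rightarrow> real^'n \<Rightarrow> real^'l \<Rightarrow> real^'l \<Rightarrow> ereal" where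
  "dual_max P xI \<zeta> d = (SUP u \<in> dual_opt P xI \<zeta>. ereal (u \<bullet> d))"

text \<open>\<open>dual_max\<close> is a genuine maximum, or \<open>\<infinity>\<close> because the objective is unbounded.\<close>

definition dual_max_attained :: "('n::finite, 'm::finite, 'l::finite) momilp \<Rightarrow> real^'n \<Rightarrow> real^'l \<Rightarrow> real^'l \<Rightarrow> bool" where
  "dual_max_attained P xI \<zeta> d \<longleftrightarrow>
     (bdd_above ((\<lambda>u. u \<bullet> d) ` dual_opt P xI \<zeta>) \<longrightarrow>
      (\<exists>u \<in> dual_opt P xI \<zeta>. dual_max P xI \<zeta> d = ereal (u \<bullet> d)))"

text \<open>
  The limit is taken in \<^typ>\<open>ereal\<close>, so it may be infinite. \<open>dir_deriv\<close> is unspecified if the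
  limit does not exist, hence the separate existence predicate.
\<close>

definition dir_quotient :: "('a::real_vector \<Rightarrow> ereal) \<Rightarrow> 'a \<Rightarrow> 'a \<Rightarrow> real \<Rightarrow> ereal" where
  "dir_quotient f \<zeta> d t = (f (\<zeta> + t *\<^sub>R d) - f \<zeta>) / ereal t"

definition has_dir_deriv :: "('a::real_vector \<Rightarrow> ereal) \<Rightarrow> 'a \<Rightarrow> 'a \<Rightarrow> bool" where
  "has_dir_deriv f \<zeta> d \<longleftrightarrow> (\<exists>L. (dir_quotient f \<zeta> d \<longlongrightarrow> L) (at_right 0))"

definition dir_deriv :: "('a::real_vector \<Rightarrow> ereal) \<Rightarrow> 'a \<Rightarrow> 'a \<Rightarrow> ereal" where
  "dir_deriv f \<zeta> d = Lim (at_right 0) (dir_quotient f \<zeta> d)"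

end

theory Submission
  imports Defs
begin

text \<open>
  Since \<open>X_MO P\<close> is bounded, only finitely many integer parts occur, and a description \<open>S\<close> makes the
  restricted value function the pointwise minimum of the finitely many functions \<open>zbar P xI\<close> with
  \<open>xI \<in> S\<close> (\<open>rvf_eq_Min_description\<close>). The quotient of a finite minimum is governed by the functions
  active at \<open>\<zeta>\<close>, provided the others stay above the minimum by a gap near \<open>\<zeta>\<close>
  (\<open>dir_quotient_Min\<close>). This gap is lower semicontinuity of the value of a linear program with
  bounded feasible set, and follows from compactness (\<open>eventually_z_LP_ge\<close>).

  It remains to differentiate a single \<open>zbar P xI\<close>, the value of a linear program as a function of its
  right-hand side. Each optimal dual solution \<open>(u, v)\<close> stays dual feasible when the right-hand side
  moves, so by weak duality the quotient is at least \<open>u \<bullet> d\<close>. Conversely, suppose that \<open>u \<bullet> d\<close> has the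
  upper bound \<open>M\<close> on the optimal dual face. By linear programming duality this bound has a
  certificate, and the certificate is itself a primal direction along which an optimal solution can
  be moved at cost rate at most \<open>M\<close> (\<open>z_LP_le_along_direction\<close>). Hence the quotient equals
  \<open>dual_max P xI \<zeta> d\<close> for all small \<open>t > 0\<close>, with value \<open>\<infinity>\<close> when the face is unbounded in direction
  \<open>d\<close> (\<open>dir_quotient_zbar\<close>). This already gives the first branch of the case distinction. In the second
  branch every \<open>dual_max P xI \<zeta> d\<close> is \<open>\<infinity>\<close>, because a generator witnessing membership in
  \<open>delta_minus\<close> is a recession direction of the optimal face (\<open>dual_max_eq_infinity\<close>).

  All duality facts come from separating a point from a finitely generated, hence closed, cone
  (\<open>farkas_cone\<close>).
\<close>

section \<open>Farkas certificates and linear programming duality\<close>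

text \<open>
  A finitely generated cone is closed, so a point outside it is strictly separated from it; the
  separating level can be moved to \<open>0\<close> because the set is a cone. Indexing the generators, instead
  of taking a set of them, allows repetitions and lets the multipliers be read off by index.
\<close>

lemma farkas_cone:
  fixes a :: "'i \<Rightarrow> 'a::euclidean_space"
  assumes fin: "finite I"
    and no: "\<not> (\<exists>l. (\<forall>i\<in>I. 0 \<le> l i) \<and> (\<Sum>i\<in>I. l i *\<^sub>R a i) = g)"
  shows "\<exists>y. 0 < y \<bullet> g \<and> (\<forall>i\<in>I. y \<bullet> a i \<le> 0)"
proof -
  define K where "K = convex_cone hull (a ` I)"
  define L where "L = {x. \<exists>l. (\<forall>i\<in>I. 0 \<le> l i) \<and> x = (\<Sum>i\<in>I. l i *\<^sub>R a i)}"
  have cL: "convex_cone L"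
    unfolding convex_cone_iff
  proof (intro conjI ballI allI impI)
    show "0 \<in> L" unfolding L_def by (intro CollectI exI[of _ "\<lambda>_. 0"]) simp
  next
    fix x y assume "x \<in> L" "y \<in> L"
    then obtain l m where "\<forall>i\<in>I. 0 \<le> l i" "x = (\<Sum>i\<in>I. l i *\<^sub>R a i)"
       "\<forall>i\<in>I. 0 \<le> m i" "y = (\<Sum>i\<in>I. m i *\<^sub>R a i)"
      unfolding L_def by auto
    then show "x + y \<in> L" unfolding L_def
      by (intro CollectI exI[of _ "\<lambda>i. l i + m i"]) (auto simp: sum.distrib scaleR_add_left)
  next
    fix x c assume "x \<in> L" "0 \<le> (c::real)"
    then obtain l where "\<forall>i\<in>I. 0 \<le> l i" "x = (\<Sum>i\<in>I. l i *\<^sub>R a i)"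
      unfolding L_def by auto
    then show "c *\<^sub>R x \<in> L" unfolding L_def using \<open>0 \<le> c\<close>
      by (intro CollectI exI[of _ "\<lambda>i. c * l i"]) (auto simp: scaleR_sum_right)
  qed
  have "a ` I \<subseteq> L"
  proof
    fix x assume "x \<in> a ` I"
    then obtain k where "k \<in> I" "x = a k" by auto
    then show "x \<in> L" unfolding L_def using fin
      by (intro CollectI exI[of _ "\<lambda>i. if i = k then 1 else 0"])
        (auto simp: if_distrib[of "\<lambda>c. c *\<^sub>R _"] cong: if_cong)
  qed
  then have "K \<subseteq> L" unfolding K_def by (intro hull_minimal cL)
  with no have "g \<notin> K" unfolding L_def by auto
  have "closed K" "convex K"
    unfolding K_def using fin by (auto intro: closed_convex_cone_hull convex_convex_cone_hull)
  then obtain y b where yb: "y \<bullet> g < b" "\<And>x. x \<in> K \<Longrightarrow> b < y \<bullet> x"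
    using separating_hyperplane_closed_point[of K g] \<open>g \<notin> K\<close> by auto
  have "0 \<in> K" unfolding K_def by (rule convex_cone_hull_contains_0)
  with yb(2)[of 0] have "b < 0" by simp
  have "0 \<le> y \<bullet> a i" if "i \<in> I" for i
  proof (rule ccontr)
    assume neg: "\<not> 0 \<le> y \<bullet> a i"
    have "(b / (y \<bullet> a i)) *\<^sub>R a i \<in> K"
      unfolding K_def using neg \<open>b < 0\<close> that
      by (intro convex_cone_hull_mul hull_inc) (auto simp: zero_le_divide_iff)
    from yb(2)[OF this] neg show False by simp
  qed
  with yb(1) \<open>b < 0\<close> show ?thesis
    by (intro exI[of _ "- y"]) auto
qed

text \<open>
  The homogenisation from which the other forms are read: each inequality \<open>a i \<bullet> y \<le> b i\<close> is lifted to
  the generator \<open>(a i, b i)\<close>, and the extra generator \<open>(0, 1)\<close> turns \<open>=\<close> into \<open>\<le>\<close> in the last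
  coordinate. The homogenising variable \<open>s\<close> is positive when \<open>y / s\<close> is a genuine solution of the
  system, and \<open>0\<close> when \<open>y\<close> is only a recession direction.
\<close>

lemma farkas_affine:
  fixes a :: "'i \<Rightarrow> 'a::euclidean_space" and b :: "'i \<Rightarrow> real"
  assumes fin: "finite I"
    and no: "\<not> (\<exists>l. (\<forall>i\<in>I. 0 \<le> l i) \<and> (\<Sum>i\<in>I. l i *\<^sub>R a i) = g \<and> (\<Sum>i\<in>I. l i * b i) \<le> M)"
  shows "\<exists>y s. 0 \<le> s \<and> (\<forall>i\<in>I. a i \<bullet> y \<le> s * b i) \<and> s * M < g \<bullet> y"
proof -
  let ?I = "insert None (Some ` I)"
  let ?a = "case_option (0, 1) (\<lambda>i. (a i, b i)) :: 'i option \<Rightarrow> 'a \<times> real"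
  have sum: "(\<Sum>i\<in>?I. l i *\<^sub>R ?a i) =
      (\<Sum>i\<in>I. l (Some i) *\<^sub>R a i, l None + (\<Sum>i\<in>I. l (Some i) * b i))" for l
    using fin by (simp add: sum.reindex sum_prod)
  have "\<not> (\<exists>l. (\<forall>i\<in>?I. 0 \<le> l i) \<and> (\<Sum>i\<in>?I. l i *\<^sub>R ?a i) = (g, M))"
  proof
    assume "\<exists>l. (\<forall>i\<in>?I. 0 \<le> l i) \<and> (\<Sum>i\<in>?I. l i *\<^sub>R ?a i) = (g, M)"
    then obtain l where "\<forall>i\<in>?I. 0 \<le> l i" and "(\<Sum>i\<in>?I. l i *\<^sub>R ?a i) = (g, M)"
      by blast
    with no show False unfolding sum by (auto dest!: spec[of _ "\<lambda>i. l (Some i)"])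
  qed
  from farkas_cone[OF _ this] fin obtain y where "0 < y \<bullet> (g, M)" "\<forall>i\<in>?I. y \<bullet> ?a i \<le> 0"
    by auto
  then show ?thesis
    by (intro exI[of _ "fst y"] exI[of _ "- snd y"])
      (auto simp: inner_prod_def inner_commute algebra_simps)
qed

lemma farkas_infeasible:
  fixes a :: "'i \<Rightarrow> 'a::euclidean_space" and b :: "'i \<Rightarrow> real"
  assumes fin: "finite I" and no: "\<not> (\<exists>y. \<forall>i\<in>I. a i \<bullet> y \<le> b i)"
  obtains l where "\<And>i. i \<in> I \<Longrightarrow> 0 \<le> l i" "(\<Sum>i\<in>I. l i *\<^sub>R a i) = 0" "(\<Sum>i\<in>I. l i * b i) < 0"
proof (cases "\<exists>l. (\<forall>i\<in>I. 0 \<le> l i) \<and> (\<Sum>i\<in>I. l i *\<^sub>R a i) = 0 \<and> (\<Sum>i\<in>I. l i * b i) \<le> -1")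
  case True
  then show ?thesis using that by fastforce
next
  case False
  from farkas_affine[OF fin this] obtain y s where
    "0 \<le> s" and y: "\<forall>i\<in>I. a i \<bullet> y \<le> s * b i" and "s * -1 < 0 \<bullet> y" by blast
  then have "0 < s" by simp
  with y have "\<forall>i\<in>I. a i \<bullet> (y /\<^sub>R s) \<le> b i" by (simp add: field_simps)
  with no show ?thesis by blast
qed

text \<open>
  Without multipliers, \<open>farkas_affine\<close> would yield either a feasible point above the level \<open>M\<close> or a
  recession direction along which the objective is unbounded.
\<close>

lemma lp_multipliers:
  fixes a :: "'i \<Rightarrow> 'a::euclidean_space" and b :: "'i \<Rightarrow> real"
  assumes fin: "finite I" and y0: "\<forall>i\<in>I. a i \<bullet> y0 \<le> b i"
    and M: "\<And>y. \<forall>i\<in>I. a i \<bullet> y \<le> b i \<Longrightarrow> g \<bullet> y \<le> M"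
  obtains l where "\<And>i. i \<in> I \<Longrightarrow> 0 \<le> l i" "(\<Sum>i\<in>I. l i *\<^sub>R a i) = g" "(\<Sum>i\<in>I. l i * b i) \<le> M"
proof (cases "\<exists>l. (\<forall>i\<in>I. 0 \<le> l i) \<and> (\<Sum>i\<in>I. l i *\<^sub>R a i) = g \<and> (\<Sum>i\<in>I. l i * b i) \<le> M")
  case True
  then show ?thesis using that by blast
next
  case False
  from farkas_affine[OF fin this] obtain y s where
    s: "0 \<le> s" and y: "\<forall>i\<in>I. a i \<bullet> y \<le> s * b i" and gy: "s * M < g \<bullet> y" by blast
  show ?thesis
  proof (cases "s = 0")
    case False
    with s have "0 < s" by simp
    with y have "\<forall>i\<in>I. a i \<bullet> (y /\<^sub>R s) \<le> b i" by (simp add: field_simps)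
    from M[OF this] gy \<open>0 < s\<close> show ?thesis by (simp add: field_simps)
  next
    case True
    \<comment> \<open>moving this far along the recession direction makes the objective exceed \<open>M\<close> by 1\<close>
    define k where "k = (M - g \<bullet> y0 + 1) / (g \<bullet> y)"
    have "0 < g \<bullet> y" using gy True by simp
    moreover have "g \<bullet> y0 \<le> M" using M[OF y0] .
    ultimately have k: "0 \<le> k" "k * (g \<bullet> y) = M - g \<bullet> y0 + 1"
      unfolding k_def by auto
    have "a i \<bullet> (y0 + k *\<^sub>R y) \<le> b i" if "i \<in> I" for i
    proof -
      have "k * (a i \<bullet> y) \<le> 0" using y True that k by (simp add: mult_nonneg_nonpos)
      with y0 that show ?thesis by (force simp: inner_add_right)
    qed
    then have "g \<bullet> (y0 + k *\<^sub>R y) \<le> M" by (intro M) auto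
    with k show ?thesis by (simp add: inner_add_right)
  qed
qed

text \<open>
  If no feasible point reached the supremum \<open>m\<close>, then adding the inequality \<open>g \<bullet> y \<ge> m\<close> would make the
  system infeasible. In a Farkas certificate this inequality has a positive multiplier, since the
  rest is feasible; dividing by it bounds the objective by a number below \<open>m\<close>.
\<close>

lemma lp_max_attained:
  fixes a :: "'i \<Rightarrow> 'a::euclidean_space" and b :: "'i \<Rightarrow> real"
  assumes fin: "finite I" and y0: "\<forall>i\<in>I. a i \<bullet> y0 \<le> b i"
    and M: "\<And>y. \<forall>i\<in>I. a i \<bullet> y \<le> b i \<Longrightarrow> g \<bullet> y \<le> M"
  obtains y where "\<forall>i\<in>I. a i \<bullet> y \<le> b i"
    and "\<And>x. \<forall>i\<in>I. a i \<bullet> x \<le> b i \<Longrightarrow> g \<bullet> x \<le> g \<bullet> y"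
proof -
  define F where "F = {y. \<forall>i\<in>I. a i \<bullet> y \<le> b i}"
  define m where "m = (SUP y\<in>F. g \<bullet> y)"
  have "y0 \<in> F" using y0 by (simp add: F_def)
  have bdd: "bdd_above ((\<bullet>) g ` F)" unfolding F_def using M by (intro bdd_aboveI2[of _ _ M]) auto
  then have up: "g \<bullet> y \<le> m" if "y \<in> F" for y
    unfolding m_def using that by (rule cSUP_upper2) simp
  have "\<exists>y\<in>F. m \<le> g \<bullet> y"
  proof (rule ccontr)
    assume not: "\<not> (\<exists>y\<in>F. m \<le> g \<bullet> y)"
    let ?I = "insert None (Some ` I)"
    let ?a = "case_option (- g) a" and ?b = "case_option (- m) b"
    have inf: "\<not> (\<exists>y. \<forall>i\<in>?I. ?a i \<bullet> y \<le> ?b i)" using not by (auto simp: F_def)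
    have "finite ?I" using fin by simp
    from farkas_infeasible[OF this inf] obtain l where l: "\<And>i. i \<in> ?I \<Longrightarrow> 0 \<le> l i"
      and "(\<Sum>i\<in>?I. l i *\<^sub>R ?a i) = 0" "(\<Sum>i\<in>?I. l i * ?b i) < 0"
      by blast
    then have la: "(\<Sum>i\<in>I. l (Some i) *\<^sub>R a i) = l None *\<^sub>R g"
      and lb: "(\<Sum>i\<in>I. l (Some i) * b i) < l None * m"
      using fin by (simp_all add: sum.reindex add_eq_0_iff2)
    have weak: "l None * (g \<bullet> y) \<le> (\<Sum>i\<in>I. l (Some i) * b i)" if "y \<in> F" for y
    proof -
      have "l None * (g \<bullet> y) = (\<Sum>i\<in>I. l (Some i) * (a i \<bullet> y))"
        using arg_cong[OF la, of "\<lambda>v. v \<bullet> y"] by (simp add: inner_sum_left)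
      also have "\<dots> \<le> (\<Sum>i\<in>I. l (Some i) * b i)"
        using that l by (intro sum_mono mult_left_mono) (auto simp: F_def)
      finally show ?thesis .
    qed
    have "l None \<noteq> 0" using weak[OF \<open>y0 \<in> F\<close>] lb by auto
    with l[of None] have pos: "0 < l None" by simp
    have "m \<le> (\<Sum>i\<in>I. l (Some i) * b i) / l None"
      unfolding m_def using \<open>y0 \<in> F\<close> weak pos
      by (intro cSUP_least) (auto simp: field_simps)
    with lb pos show False by (simp add: field_simps)
  qed
  then show ?thesis using that up unfolding F_def by (smt (verit) mem_Collect_eq)
qed

section \<open>The continuous linear program and its dual\<close>

abbreviation lp_feas :: "('n::finite, 'm::finite, 'l::finite) momilp \<Rightarrow> real^'l \<Rightarrow> real^'m \<Rightarrow> (real^'n) set" where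
  "lp_feas P p q \<equiv> {x \<in> cont_part P. Cm P *v x \<le> p \<and> Am P *v x = q}"

lemma inner_vec_mono:
  fixes x y z :: "real^'k"
  assumes "\<And>i. x $ i * z $ i \<le> y $ i * z $ i"
  shows "x \<bullet> z \<le> y \<bullet> z"
  unfolding inner_vec_def using assms by (intro sum_mono) simp

lemma inner_matrix_transpose:
  "(A *v x) \<bullet> u = (u v* A) \<bullet> x" for A :: "real^'n^'k"
  by (metis dot_lmul_matrix inner_commute)

text \<open>
  The sign conditions \<open>u \<le> 0\<close> and \<open>x \<ge> 0\<close> let each side's inequalities be multiplied by the variables
  of the other. In integer columns \<open>x\<close> vanishes, which is why the dual may ignore them.
\<close>

lemma lp_weak_duality:
  assumes x: "x \<in> lp_feas P p q" and y: "(u, v) \<in> dual_feas P"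
  shows "p \<bullet> u + q \<bullet> v \<le> c0 P \<bullet> x"
proof -
  have u: "u $ i \<le> 0" for i using y by (simp add: dual_feas_def less_eq_vec_def)
  have "p \<bullet> u \<le> (Cm P *v x) \<bullet> u"
    using x u by (intro inner_vec_mono mult_right_mono_neg) (simp_all add: less_eq_vec_def)
  then have "p \<bullet> u + q \<bullet> v \<le> (Cm P *v x) \<bullet> u + (Am P *v x) \<bullet> v" using x by simp
  also have "\<dots> = (transpose (Cm P) *v u + transpose (Am P) *v v) \<bullet> x"
    by (simp add: inner_matrix_transpose inner_add_left)
  also have "\<dots> \<le> c0 P \<bullet> x"
  proof (intro inner_vec_mono)
    fix j show "(transpose (Cm P) *v u + transpose (Am P) *v v) $ j * x $ j \<le> c0 P $ j * x $ j"
      using x y by (cases "j \<in> ints P") (auto simp: cont_part_def dual_feas_def intro: mult_right_mono)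
  qed
  finally show ?thesis .
qed

lemma z_LP_ge_dual:
  assumes "(u, v) \<in> dual_feas P"
  shows "ereal (p \<bullet> u + q \<bullet> v) \<le> z_LP P p q"
  unfolding z_LP_def using lp_weak_duality[OF _ assms] by (intro INF_greatest) (simp only: ereal_less_eq)

lemma z_LP_le: "x \<in> lp_feas P p q \<Longrightarrow> z_LP P p q \<le> ereal (c0 P \<bullet> x)"
  unfolding z_LP_def by (rule INF_lower)

text \<open>
  The dual constraints together with the requirement that the dual objective be at least \<open>\<phi>\<close>,
  written as one indexed system of inequalities: \<open>Some (Inl j)\<close> is the inequality of column \<open>j\<close>,
  \<open>Some (Inr i)\<close> the sign condition on \<open>u $ i\<close>, and \<open>None\<close> the level inequality. When \<open>\<phi>\<close> is the
  optimal value, its solution set is the optimal face.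
\<close>

definition dual_rows :: "('n::finite, 'm::finite, 'l::finite) momilp \<Rightarrow> ('n + 'l) option set" where
  "dual_rows P = insert None (Some ` ((- ints P) <+> UNIV))"

definition dual_row :: "('n::finite, 'm::finite, 'l::finite) momilp \<Rightarrow> real^'l \<Rightarrow> real^'m \<Rightarrow>
    ('n + 'l) option \<Rightarrow> (real^'l) \<times> (real^'m)" where
  "dual_row P p q =
     case_option (- p, - q) (case_sum (\<lambda>j. (column j (Cm P), column j (Am P))) (\<lambda>i. (axis i 1, 0)))"

definition dual_rhs :: "('n::finite, 'm::finite, 'l::finite) momilp \<Rightarrow> real \<Rightarrow>
    ('n + 'l) option \<Rightarrow> real" where
  "dual_rhs P \<phi> = case_option (- \<phi>) (case_sum (\<lambda>j. c0 P $ j) (\<lambda>i. 0))"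

lemma finite_dual_rows: "finite (dual_rows P)"
  by (simp add: dual_rows_def)

lemma inner_column: "column j A \<bullet> u = (u v* A) $ j" for A :: "real^'n^'k"
  by (simp add: vector_matrix_mult_def column_def inner_vec_def mult.commute)

lemma dual_rows_iff:
  fixes P :: "('n::finite, 'm::finite, 'l::finite) momilp"
  shows
  "(\<forall>i\<in>dual_rows P. dual_row P p q i \<bullet> (u, v) \<le> dual_rhs P \<phi> i) \<longleftrightarrow>
     (u, v) \<in> dual_feas P \<and> \<phi> \<le> p \<bullet> u + q \<bullet> v"
proof -
  have Plus: "(\<forall>i\<in>A <+> B. Q i) \<longleftrightarrow> (\<forall>j\<in>A. Q (Inl j)) \<and> (\<forall>i\<in>B. Q (Inr i))"
    for A :: "'n set" and B :: "'l set" and Q by auto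
  show ?thesis
    unfolding dual_rows_def dual_row_def dual_rhs_def dual_feas_def
    by (auto simp: Plus less_eq_vec_def inner_column inner_axis')
qed

text \<open>
  Multipliers of the system are primal objects: those of the columns form a vector \<open>w\<close>, those of the
  sign conditions are its slacks, and \<open>s\<close> belongs to the level inequality. For \<open>s > 0\<close> and \<open>(g, h) = 0\<close>
  the point \<open>w / s\<close> is primal feasible.
\<close>

lemma dual_rows_combination:
  fixes P :: "('n::finite, 'm::finite, 'l::finite) momilp"
  assumes l: "\<And>i. i \<in> dual_rows P \<Longrightarrow> 0 \<le> l i"
    and sum: "(\<Sum>i\<in>dual_rows P. l i *\<^sub>R dual_row P p q i) = (g, h)"
  obtains w s where "w \<in> cont_part P" "0 \<le> s"
    "Cm P *v w \<le> g + s *\<^sub>R p" "Am P *v w = h + s *\<^sub>R q"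
    "(\<Sum>i\<in>dual_rows P. l i * dual_rhs P \<phi> i) = c0 P \<bullet> w - s * \<phi>"
proof -
  define w :: "real^'n" where "w = (\<chi> j. if j \<in> ints P then 0 else l (Some (Inl j)))"
  define r :: "real^'l" where "r = (\<chi> i. l (Some (Inr i)))"
  define s where "s = l None"
  have split: "(\<Sum>i\<in>dual_rows P. f i) =
      f None + ((\<Sum>j\<in>- ints P. f (Some (Inl j))) + (\<Sum>i\<in>UNIV. f (Some (Inr i))))"
    for f :: "_ \<Rightarrow> 'z::comm_monoid_add"
    by (simp add: dual_rows_def sum.reindex sum.Plus)
  have cols: "(\<Sum>j\<in>- ints P. l (Some (Inl j)) *\<^sub>R column j A) = A *v w" for A :: "real^'n^'k"
    unfolding matrix_mult_sum scalar_mult_eq_scaleR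
    by (rule sum.mono_neutral_cong_left) (auto simp: w_def)
  have slack: "(\<Sum>i\<in>UNIV. l (Some (Inr i)) *\<^sub>R axis i (1::real)) = r"
    by (simp add: r_def vec_eq_iff axis_def if_distrib cong: if_cong)
  have obj: "(\<Sum>j\<in>- ints P. l (Some (Inl j)) * c0 P $ j) = c0 P \<bullet> w"
    unfolding inner_vec_def by (rule sum.mono_neutral_cong_left) (auto simp: w_def)
  have "(g, h) = (Cm P *v w + r - s *\<^sub>R p, Am P *v w - s *\<^sub>R q)"
    unfolding sum[symmetric] split dual_row_def
    by (simp add: sum_prod cols slack s_def)
  moreover have "0 \<le> r $ i" for i using l[of "Some (Inr i)"] by (auto simp: r_def dual_rows_def)
  moreover have "w \<in> cont_part P" using l by (auto simp: w_def cont_part_def dual_rows_def)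
  moreover have "0 \<le> s" using l by (simp add: s_def dual_rows_def)
  moreover have "(\<Sum>i\<in>dual_rows P. l i * dual_rhs P \<phi> i) = c0 P \<bullet> w - s * \<phi>"
    unfolding split dual_rhs_def by (simp add: obj s_def)
  ultimately show ?thesis by (intro that[of w s]) (auto simp: less_eq_vec_def)
qed

lemma cont_part_cone:
  assumes "x \<in> cont_part P" "y \<in> cont_part P" "0 \<le> k" "0 \<le> (m::real)"
  shows "k *\<^sub>R x + m *\<^sub>R y \<in> cont_part P"
  using assms by (simp add: cont_part_def)

text \<open>
  If no dual point reached the value of an optimal \<open>x\<close>, the certificate \<open>(w, s)\<close> would give the
  feasible point \<open>(x + w) / (1 + s)\<close> of smaller cost. Averaging with \<open>x\<close> treats the cases \<open>s > 0\<close> and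
  \<open>s = 0\<close> alike.
\<close>

lemma lp_strong_duality:
  assumes x: "x \<in> lp_feas P p q" and opt: "z_LP P p q = ereal (c0 P \<bullet> x)"
  obtains u v where "(u, v) \<in> dual_feas P" "p \<bullet> u + q \<bullet> v = c0 P \<bullet> x"
proof -
  let ?\<phi> = "c0 P \<bullet> x"
  have "\<exists>y. \<forall>i\<in>dual_rows P. dual_row P p q i \<bullet> y \<le> dual_rhs P ?\<phi> i"
  proof (rule ccontr)
    assume no: "\<not> ?thesis"
    from farkas_infeasible[OF finite_dual_rows no] obtain l
      where l: "\<And>i. i \<in> dual_rows P \<Longrightarrow> 0 \<le> l i"
        and s0: "(\<Sum>i\<in>dual_rows P. l i *\<^sub>R dual_row P p q i) = (0, 0)"
        and neg: "(\<Sum>i\<in>dual_rows P. l i * dual_rhs P ?\<phi> i) < 0"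
      unfolding zero_prod_def by blast
    obtain w s where w: "w \<in> cont_part P" "0 \<le> s"
      "Cm P *v w \<le> 0 + s *\<^sub>R p" "Am P *v w = 0 + s *\<^sub>R q"
      "(\<Sum>i\<in>dual_rows P. l i * dual_rhs P ?\<phi> i) = c0 P \<bullet> w - s * ?\<phi>"
      by (rule dual_rows_combination[OF l s0])
    have "(x + w) /\<^sub>R (1 + s) \<in> lp_feas P p q"
    proof -
      have 1: "(x + w) /\<^sub>R (1 + s) \<in> cont_part P"
        using cont_part_cone[of x P w "inverse (1 + s)" "inverse (1 + s)"] x w
        by (simp add: scaleR_add_right)
      have "(Cm P *v x) $ i + (Cm P *v w) $ i \<le> p $ i + s * p $ i" for i
        using x w(3) by (intro add_mono) (auto simp: less_eq_vec_def)
      then have "inverse (1 + s) * ((Cm P *v x) $ i + (Cm P *v w) $ i) \<le> p $ i" for i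
        using \<open>0 \<le> s\<close>
        unfolding divide_inverse_commute[symmetric] by (subst pos_divide_le_eq) (simp_all add: algebra_simps)
      then have 2: "Cm P *v ((x + w) /\<^sub>R (1 + s)) \<le> p"
        by (simp add: matrix_vector_mult_scaleR matrix_vector_right_distrib less_eq_vec_def)
      have "Am P *v (x + w) = (1 + s) *\<^sub>R q"
        using x w by (simp add: matrix_vector_right_distrib scaleR_add_left)
      then have 3: "Am P *v ((x + w) /\<^sub>R (1 + s)) = q" using \<open>0 \<le> s\<close>
        by (simp add: matrix_vector_mult_scaleR)
      from 1 2 3 show ?thesis by simp
    qed
    from z_LP_le[OF this] opt have "?\<phi> \<le> (?\<phi> + c0 P \<bullet> w) / (1 + s)"
      by (simp add: inner_add_right divide_inverse_commute)
    with neg w(2,5) show False by (simp add: field_simps)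
  qed
  then obtain u v where uv: "(u, v) \<in> dual_feas P" "?\<phi> \<le> p \<bullet> u + q \<bullet> v"
    by (auto simp only: split_paired_Ex dual_rows_iff)
  with lp_weak_duality[OF x uv(1)] that[of u v] show ?thesis by simp
qed

text \<open>
  The upper bound for the directional derivative. That \<open>u \<bullet> d \<le> M\<close> on the optimal face is certified by
  multipliers \<open>(w, s)\<close>, and these describe a primal move: for small \<open>t\<close> the point
  \<open>(1 - t * s) *\<^sub>R x + t *\<^sub>R w\<close> is feasible for the right-hand side \<open>p + t *\<^sub>R d\<close> and costs at most
  \<open>t * M\<close> more than \<open>x\<close>. In particular the perturbed program stays feasible.
\<close>

lemma z_LP_le_along_direction:
  assumes x: "x \<in> lp_feas P p q" and opt: "z_LP P p q = ereal (c0 P \<bullet> x)"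
    and M: "\<And>u v. (u, v) \<in> dual_feas P \<Longrightarrow> p \<bullet> u + q \<bullet> v = c0 P \<bullet> x \<Longrightarrow> u \<bullet> d \<le> M"
  shows "\<forall>\<^sub>F t in at_right 0. z_LP P (p + t *\<^sub>R d) q \<le> ereal (c0 P \<bullet> x + t * M)"
proof -
  let ?\<phi> = "c0 P \<bullet> x"
  obtain u0 v0 where "(u0, v0) \<in> dual_feas P" "p \<bullet> u0 + q \<bullet> v0 = ?\<phi>"
    using lp_strong_duality[OF x opt] .
  then have y0: "\<forall>i\<in>dual_rows P. dual_row P p q i \<bullet> (u0, v0) \<le> dual_rhs P ?\<phi> i"
    by (simp add: dual_rows_iff)
  have bound: "(d, 0) \<bullet> y \<le> M" if "\<forall>i\<in>dual_rows P. dual_row P p q i \<bullet> y \<le> dual_rhs P ?\<phi> i" for y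
  proof -
    obtain u v where y: "y = (u, v)" by fastforce
    with that have "(u, v) \<in> dual_feas P" "?\<phi> \<le> p \<bullet> u + q \<bullet> v" by (auto simp: dual_rows_iff)
    with lp_weak_duality[OF x] have "u \<bullet> d \<le> M" by (intro M) (auto intro: antisym)
    with y show ?thesis by (simp add: inner_commute)
  qed
  obtain l where l: "\<And>i. i \<in> dual_rows P \<Longrightarrow> 0 \<le> l i"
    and s0: "(\<Sum>i\<in>dual_rows P. l i *\<^sub>R dual_row P p q i) = (d, 0)"
    and le: "(\<Sum>i\<in>dual_rows P. l i * dual_rhs P ?\<phi> i) \<le> M"
    using lp_multipliers[OF finite_dual_rows y0 bound] by blast
  obtain w s where w: "w \<in> cont_part P" "0 \<le> s"
    "Cm P *v w \<le> d + s *\<^sub>R p" "Am P *v w = 0 + s *\<^sub>R q"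
    "(\<Sum>i\<in>dual_rows P. l i * dual_rhs P ?\<phi> i) = c0 P \<bullet> w - s * ?\<phi>"
    by (rule dual_rows_combination[OF l s0])
  \<comment> \<open>any bound that gives \<open>t * s \<le> 1\<close> works; this one is also meaningful for \<open>s = 0\<close>\<close>
  have "z_LP P (p + t *\<^sub>R d) q \<le> ereal (?\<phi> + t * M)" if t: "0 < t" "t < 1 / (1 + s)" for t
  proof -
    have "t * (1 + s) < 1" using t w(2) by (simp add: field_simps)
    then have ts: "0 \<le> 1 - t * s" using t by (simp add: algebra_simps)
    let ?x = "(1 - t * s) *\<^sub>R x + t *\<^sub>R w"
    have "(1 - t * s) * (Cm P *v x) $ i + t * (Cm P *v w) $ i \<le>
        (1 - t * s) * p $ i + t * (d $ i + s * p $ i)" for i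
      using x w(3) t ts by (intro add_mono mult_left_mono) (auto simp: less_eq_vec_def)
    then have "Cm P *v ?x \<le> p + t *\<^sub>R d"
      by (simp add: matrix_vector_right_distrib matrix_vector_mult_scaleR less_eq_vec_def algebra_simps)
    moreover have "Am P *v ?x = q"
      using x w(4) by (simp add: matrix_vector_right_distrib matrix_vector_mult_scaleR algebra_simps)
    moreover have "?x \<in> cont_part P" using x w(1) t ts by (intro cont_part_cone) auto
    ultimately have "z_LP P (p + t *\<^sub>R d) q \<le> ereal (c0 P \<bullet> ?x)" by (intro z_LP_le) simp
    also have "c0 P \<bullet> ?x = ?\<phi> + t * (c0 P \<bullet> w - s * ?\<phi>)" by (simp add: inner_add_right algebra_simps)
    also have "\<dots> \<le> ?\<phi> + t * M" using le w(5) t by simp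
    finally show ?thesis by simp
  qed
  moreover have "\<forall>\<^sub>F t in at_right 0. t < 1 / (1 + s)"
    using w(2) by (intro order_tendstoD(2)[OF tendsto_ident_at]) simp
  ultimately show ?thesis
    using eventually_at_right_less[of 0] by (auto elim: eventually_elim2)
qed

definition lp_dual_opt :: "('n::finite, 'm::finite, 'l::finite) momilp \<Rightarrow> real^'l \<Rightarrow> real^'m \<Rightarrow> (real^'l) set" where
  "lp_dual_opt P p q = {u. \<exists>v. (u, v) \<in> dual_feas P \<and> ereal (p \<bullet> u + q \<bullet> v) = z_LP P p q}"

lemma lp_dual_max_attained:
  assumes x: "x \<in> lp_feas P p q" and opt: "z_LP P p q = ereal (c0 P \<bullet> x)"
    and bdd: "bdd_above ((\<lambda>u. u \<bullet> d) ` lp_dual_opt P p q)"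
  shows "\<exists>u\<in>lp_dual_opt P p q. \<forall>u'\<in>lp_dual_opt P p q. u' \<bullet> d \<le> u \<bullet> d"
proof -
  let ?\<phi> = "c0 P \<bullet> x"
  let ?F = "\<lambda>y. \<forall>i\<in>dual_rows P. dual_row P p q i \<bullet> y \<le> dual_rhs P ?\<phi> i"
  have F: "?F (u, v) \<longleftrightarrow> (u, v) \<in> dual_feas P \<and> ereal (p \<bullet> u + q \<bullet> v) = z_LP P p q" for u v
    unfolding dual_rows_iff opt using lp_weak_duality[OF x] by (auto intro: antisym)
  obtain u0 v0 where "(u0, v0) \<in> dual_feas P" "p \<bullet> u0 + q \<bullet> v0 = ?\<phi>"
    using lp_strong_duality[OF x opt] .
  then have y0: "?F (u0, v0)" by (simp add: dual_rows_iff)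
  obtain M where M: "u \<bullet> d \<le> M" if "u \<in> lp_dual_opt P p q" for u
    using bdd by (auto simp: bdd_above_def)
  have bound: "(d, 0) \<bullet> y \<le> M" if "?F y" for y
  proof -
    have "fst y \<in> lp_dual_opt P p q"
      using that F[of "fst y" "snd y"] by (auto simp: lp_dual_opt_def intro!: exI[of _ "snd y"])
    from M[OF this] show ?thesis by (simp add: inner_prod_def inner_commute)
  qed
  obtain y where y: "?F y" "\<And>y'. ?F y' \<Longrightarrow> (d, 0) \<bullet> y' \<le> (d, 0) \<bullet> y"
    using lp_max_attained[OF finite_dual_rows y0 bound] by blast
  have "fst y \<in> lp_dual_opt P p q"
    using y(1) F[of "fst y" "snd y"] by (auto simp: lp_dual_opt_def intro!: exI[of _ "snd y"])
  moreover have "u' \<bullet> d \<le> fst y \<bullet> d" if u': "u' \<in> lp_dual_opt P p q" for u'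
  proof -
    obtain v' where "?F (u', v')" using u' F by (auto simp: lp_dual_opt_def)
    from y(2)[OF this] show ?thesis by (simp add: inner_prod_def inner_commute)
  qed
  ultimately show ?thesis by blast
qed

section \<open>Attainment and lower semicontinuity\<close>

lemma closed_cont_part: "closed (cont_part P)"
proof -
  have "cont_part P = (\<Inter>j\<in>- ints P. {x. 0 \<le> x $ j}) \<inter> (\<Inter>j\<in>ints P. {x. x $ j = 0})"
    by (auto simp: cont_part_def)
  then show ?thesis
    by (auto intro!: closed_Int closed_INT closed_Collect_le closed_Collect_eq continuous_intros)
qed

lemma z_LP_attained:
  assumes ne: "lp_feas P p q \<noteq> {}" and bdd: "bounded {x \<in> cont_part P. Am P *v x = q}"
  obtains x where "x \<in> lp_feas P p q" "z_LP P p q = ereal (c0 P \<bullet> x)"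
proof -
  have eq: "lp_feas P p q = cont_part P \<inter> {x. \<forall>i. (Cm P *v x) $ i \<le> p $ i} \<inter> {x. Am P *v x = q}"
    by (auto simp: less_eq_vec_def)
  have "closed (lp_feas P p q)"
    unfolding eq
    by (intro closed_Int closed_cont_part closed_Collect_all closed_Collect_le closed_Collect_eq
        continuous_intros matrix_vector_mult_linear_continuous_on)
  moreover have "bounded (lp_feas P p q)" using bdd by (rule bounded_subset) auto
  ultimately have "compact (lp_feas P p q)" by (simp add: compact_eq_bounded_closed)
  moreover have "continuous_on (lp_feas P p q) (\<lambda>x. c0 P \<bullet> x)" by (intro continuous_intros)
  ultimately obtain x where x: "x \<in> lp_feas P p q" "\<And>y. y \<in> lp_feas P p q \<Longrightarrow> c0 P \<bullet> x \<le> c0 P \<bullet> y"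
    using continuous_attains_inf[OF _ ne] by blast
  have "z_LP P p q = ereal (c0 P \<bullet> x)"
    unfolding z_LP_def using x by (intro antisym INF_lower2[of x] INF_greatest) auto
  with x(1) that show ?thesis by blast
qed

text \<open>
  Lower semicontinuity along a ray. The pairs \<open>(t, x)\<close> with \<open>x\<close> feasible at parameter \<open>t\<close> and of cost at
  most \<open>\<gamma>\<close> form a compact set, so the parameters \<open>t\<close> that occur form a closed set. It misses \<open>0\<close>,
  hence also all small \<open>t\<close>. The argument covers a program that is infeasible at \<open>0\<close> as well.
\<close>

lemma eventually_z_LP_ge:
  assumes bdd: "bounded {x \<in> cont_part P. Am P *v x = q}" and less: "ereal \<gamma> < z_LP P p q"
  shows "\<forall>\<^sub>F t in at_right 0. ereal \<gamma> \<le> z_LP P (p + t *\<^sub>R d) q"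
proof -
  define K where "K = ({0..1} \<times> cont_part P) \<inter>
    {y. \<forall>i. (Cm P *v snd y) $ i \<le> p $ i + fst y * d $ i} \<inter>
    {y. Am P *v snd y = q} \<inter> {y. c0 P \<bullet> snd y \<le> \<gamma>}"
  have "closed K" unfolding K_def
    by (intro closed_Int closed_Times closed_cont_part closed_Collect_all closed_Collect_le
        closed_Collect_eq closed_atLeastAtMost continuous_intros
        continuous_on_compose2[OF matrix_vector_mult_linear_continuous_on[of UNIV]]) auto
  moreover have "bounded K"
    by (rule bounded_subset[OF bounded_Times[OF bounded_closed_interval[of 0 1] bdd]]) (auto simp: K_def)
  ultimately have "compact K" by (simp add: compact_eq_bounded_closed)
  then have "closed (fst ` K)"
    by (intro compact_imp_closed compact_continuous_image continuous_intros)
  moreover have "0 \<notin> fst ` K"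
  proof
    assume "0 \<in> fst ` K"
    then obtain x where "x \<in> lp_feas P p q" "c0 P \<bullet> x \<le> \<gamma>"
      by (auto simp: K_def less_eq_vec_def)
    with z_LP_le[of x P p q] less show False
      by (metis ereal_less_eq(3) leD order_trans)
  qed
  ultimately have "\<forall>\<^sub>F t in at_right 0. t \<notin> fst ` K"
    using topological_tendstoD[OF tendsto_ident_at, of "- fst ` K" 0 "{0<..}"] by (auto simp: open_Compl)
  moreover have "\<forall>\<^sub>F t in at_right 0. t < (1::real)"
    by (intro order_tendstoD(2)[OF tendsto_ident_at]) simp
  ultimately show ?thesis using eventually_at_right_less[of 0]
  proof eventually_elim
    case (elim t)
    show ?case unfolding z_LP_def
    proof (intro INF_greatest)
      fix x assume x: "x \<in> lp_feas P (p + t *\<^sub>R d) q"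
      have "\<not> c0 P \<bullet> x \<le> \<gamma>"
      proof
        assume "c0 P \<bullet> x \<le> \<gamma>"
        with x elim(2,3) have "(t, x) \<in> K" by (simp add: K_def less_eq_vec_def)
        with elim(1) show False by force
      qed
      then show "ereal \<gamma> \<le> ereal (c0 P \<bullet> x)" by simp
    qed
  qed
qed

section \<open>The derivative at a fixed integer part\<close>

text \<open>
  The difference quotient does not merely converge: it equals \<open>dual_max\<close> for all small \<open>t > 0\<close>.
  Weak duality applied to the points of the optimal face gives the lower bound for every \<open>t > 0\<close>, and
  the certificate of boundedness gives the upper bound for small \<open>t\<close>. If the face is unbounded in
  direction \<open>d\<close>, the lower bound is already \<open>\<infinity>\<close>.
\<close>

lemma dir_quotient_zbar:
  assumes x: "x \<in> lp_feas P (\<zeta> - Cm P *v xI) (bv P - Am P *v xI)"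
    and bdd: "bounded {x \<in> cont_part P. Am P *v x = bv P - Am P *v xI}"
  shows "(dir_quotient (zbar P xI) \<zeta> d \<longlongrightarrow> dual_max P xI \<zeta> d) (at_right 0)"
    and "dual_max_attained P xI \<zeta> d"
    and "dual_opt P xI \<zeta> \<noteq> {}"
proof -
  let ?p = "\<zeta> - Cm P *v xI" and ?q = "bv P - Am P *v xI"
  have D: "dual_opt P xI \<zeta> = lp_dual_opt P ?p ?q"
    by (simp add: dual_opt_def lp_dual_opt_def)
  obtain y where y: "y \<in> lp_feas P ?p ?q" and opt: "z_LP P ?p ?q = ereal (c0 P \<bullet> y)"
    using z_LP_attained[OF _ bdd] x by blast
  let ?\<phi> = "c0 P \<bullet> y"
  show ne: "dual_opt P xI \<zeta> \<noteq> {}"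
    unfolding dual_opt_def using lp_strong_duality[OF y opt] opt by fastforce
  show att: "dual_max_attained P xI \<zeta> d"
    unfolding dual_max_attained_def
  proof
    assume "bdd_above ((\<lambda>u. u \<bullet> d) ` dual_opt P xI \<zeta>)"
    then obtain u where u: "u \<in> dual_opt P xI \<zeta>" "\<forall>u'\<in>dual_opt P xI \<zeta>. u' \<bullet> d \<le> u \<bullet> d"
      using lp_dual_max_attained[OF y opt] unfolding D by blast
    then have "dual_max P xI \<zeta> d = ereal (u \<bullet> d)"
      unfolding dual_max_def by (intro antisym SUP_upper2[of u] SUP_least) auto
    with u(1) show "\<exists>u\<in>dual_opt P xI \<zeta>. dual_max P xI \<zeta> d = ereal (u \<bullet> d)" by blast
  qed
  have quot: "dir_quotient (zbar P xI) \<zeta> d t = (z_LP P (?p + t *\<^sub>R d) ?q - ereal ?\<phi>) / ereal t" for t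
  proof -
    have eq: "\<zeta> + t *\<^sub>R d - Cm P *v xI = ?p + t *\<^sub>R d" by simp
    show ?thesis unfolding dir_quotient_def zbar_def opt eq
      by (cases "z_LP P (?p + t *\<^sub>R d) ?q") simp_all
  qed
  have lower: "dual_max P xI \<zeta> d \<le> dir_quotient (zbar P xI) \<zeta> d t" if "0 < t" for t
    unfolding dual_max_def
  proof (rule SUP_least)
    fix u assume "u \<in> dual_opt P xI \<zeta>"
    then obtain v where v: "(u, v) \<in> dual_feas P" "?p \<bullet> u + ?q \<bullet> v = ?\<phi>"
      by (auto simp: dual_opt_def opt)
    have "(?p + t *\<^sub>R d) \<bullet> u + ?q \<bullet> v = ?\<phi> + t * (u \<bullet> d)"
      unfolding v(2)[symmetric] inner_add_left inner_scaleR_left inner_commute[of d u] by simp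
    then have "ereal (?\<phi> + t * (u \<bullet> d)) \<le> z_LP P (?p + t *\<^sub>R d) ?q"
      using z_LP_ge_dual[OF v(1), of "?p + t *\<^sub>R d" ?q] by metis
    then show "ereal (u \<bullet> d) \<le> dir_quotient (zbar P xI) \<zeta> d t"
      unfolding quot using that by (cases "z_LP P (?p + t *\<^sub>R d) ?q") (auto simp: field_simps)
  qed
  have "\<forall>\<^sub>F t in at_right 0. dir_quotient (zbar P xI) \<zeta> d t \<le> dual_max P xI \<zeta> d"
  proof (cases "bdd_above ((\<lambda>u. u \<bullet> d) ` dual_opt P xI \<zeta>)")
    case True
    with att obtain M where M: "dual_max P xI \<zeta> d = ereal M" by (auto simp: dual_max_attained_def)
    have bound: "u \<bullet> d \<le> M" if "(u, v) \<in> dual_feas P" "?p \<bullet> u + ?q \<bullet> v = ?\<phi>" for u v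
    proof -
      have "u \<in> dual_opt P xI \<zeta>" using that opt by (auto simp: dual_opt_def)
      then have "ereal (u \<bullet> d) \<le> dual_max P xI \<zeta> d" unfolding dual_max_def by (rule SUP_upper)
      with M show ?thesis by simp
    qed
    have "\<forall>\<^sub>F t in at_right 0. z_LP P (?p + t *\<^sub>R d) ?q \<le> ereal (?\<phi> + t * M)"
      by (rule z_LP_le_along_direction[OF y opt bound])
    with eventually_at_right_less[of 0]
    show ?thesis
    proof eventually_elim
      case (elim t)
      then show ?case unfolding quot M
        by (cases "z_LP P (?p + t *\<^sub>R d) ?q") (auto simp: field_simps)
    qed
  next
    case False
    have "dual_max P xI \<zeta> d = \<infinity>"
      unfolding dual_max_def
    proof (rule SUP_PInfty)
      fix n :: nat
      show "\<exists>u\<in>dual_opt P xI \<zeta>. ereal (real n) \<le> ereal (u \<bullet> d)"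
        using False by (fastforce simp: bdd_above_def not_le intro: less_imp_le)
    qed
    then show ?thesis by simp
  qed
  with eventually_at_right_less[of 0]
  have "\<forall>\<^sub>F t in at_right 0. dir_quotient (zbar P xI) \<zeta> d t = dual_max P xI \<zeta> d"
    by eventually_elim (auto intro: antisym lower)
  then show "(dir_quotient (zbar P xI) \<zeta> d \<longlongrightarrow> dual_max P xI \<zeta> d) (at_right 0)"
    by (rule tendsto_eventually)
qed

text \<open>
  A generator witnessing \<open>d \<in> delta_minus P R xI \<zeta>\<close> is a recession direction of the optimal dual face
  along which \<open>u \<bullet> d\<close> grows without bound.
\<close>

lemma dual_max_eq_infinity:
  assumes R: "ray_generators P R" and d: "d \<in> delta_minus P R xI \<zeta>" and ne: "dual_opt P xI \<zeta> \<noteq> {}"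
  shows "dual_max P xI \<zeta> d = \<infinity>"
proof -
  let ?p = "\<zeta> - Cm P *v xI" and ?q = "bv P - Am P *v xI"
  obtain e h where "(e, h) \<in> R" and orth: "?p \<bullet> e + ?q \<bullet> h = 0" and pos: "0 < d \<bullet> e"
    using d by (auto simp: delta_minus_def)
  then have ray: "(e, h) \<in> dual_rec_cone P"
    using R hull_subset[of R convex_cone] by (auto simp: ray_generators_def)
  obtain u v where uv: "(u, v) \<in> dual_feas P" "ereal (?p \<bullet> u + ?q \<bullet> v) = z_LP P ?p ?q"
    using ne by (auto simp: dual_opt_def)
  have shift: "u + k *\<^sub>R e \<in> dual_opt P xI \<zeta>" if "0 \<le> k" for k
  proof -
    have "(u + k *\<^sub>R e, v + k *\<^sub>R h) \<in> dual_feas P"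
      unfolding dual_feas_def
    proof (clarsimp, intro conjI allI impI)
      show "u + k *\<^sub>R e \<le> 0" using uv(1) ray that
        by (auto simp: dual_feas_def dual_rec_cone_def less_eq_vec_def
            intro!: add_nonpos_nonpos mult_nonneg_nonpos)
    next
      fix j assume j: "j \<notin> ints P"
      then have "(u v* Cm P + v v* Am P) $ j + k * (e v* Cm P + h v* Am P) $ j \<le> c0 P $ j + k * 0"
        using uv(1) ray that
        by (intro add_mono mult_left_mono) (auto simp: dual_feas_def dual_rec_cone_def)
      then show "((u + k *\<^sub>R e) v* Cm P) $ j + ((v + k *\<^sub>R h) v* Am P) $ j \<le> c0 P $ j"
        by (simp add: inner_column[symmetric] inner_add_right algebra_simps)
    qed
    moreover have "?p \<bullet> (u + k *\<^sub>R e) + ?q \<bullet> (v + k *\<^sub>R h) =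
        (?p \<bullet> u + ?q \<bullet> v) + k * (?p \<bullet> e + ?q \<bullet> h)"
      by (simp add: inner_add_right algebra_simps)
    ultimately show ?thesis using uv(2) orth by (auto simp: dual_opt_def)
  qed
  show ?thesis unfolding dual_max_def
  proof (rule SUP_PInfty)
    fix n :: nat
    define k where "k = \<bar>real n - u \<bullet> d\<bar> / (d \<bullet> e)"
    have "0 \<le> k" using pos by (simp add: k_def)
    moreover have "(u + k *\<^sub>R e) \<bullet> d = u \<bullet> d + k * (d \<bullet> e)"
      by (simp add: inner_add_left inner_commute[of e])
    then have "real n \<le> (u + k *\<^sub>R e) \<bullet> d" using pos by (simp add: k_def)
    ultimately show "\<exists>u\<in>dual_opt P xI \<zeta>. ereal (real n) \<le> ereal (u \<bullet> d)"
      using shift by (metis ereal_less_eq(3))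
  qed
qed

section \<open>The derivative of a minimum of finitely many functions\<close>


lemma tendsto_Min:
  fixes L :: "'b \<Rightarrow> 'c::linorder_topology"
  assumes "finite S" "S \<noteq> {}" "\<And>x. x \<in> S \<Longrightarrow> (g x \<longlongrightarrow> L x) F"
  shows "((\<lambda>t. Min ((\<lambda>x. g x t) ` S)) \<longlongrightarrow> Min (L ` S)) F"
  using assms
proof (induction S rule: finite_ne_induct)
  case (insert x S)
  then show ?case by (auto intro!: tendsto_min)
qed simp

text \<open>
  Subtracting \<open>f \<zeta>\<close> and dividing by \<open>t > 0\<close> is monotone, so the quotient of \<open>f\<close> is the minimum over all
  of \<open>S\<close> of the quotients of the \<open>g x\<close> taken relative to \<open>f \<zeta>\<close>. Functions that stay above the
  minimum by a fixed gap contribute quotients tending to \<open>\<infinity>\<close>, which leave the minimum unchanged.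
\<close>

lemma dir_quotient_Min:
  fixes g :: "'b \<Rightarrow> 'a::real_vector \<Rightarrow> ereal"
  assumes S: "finite S" "S \<noteq> {}"
    and f: "\<And>\<xi>. f \<xi> = Min ((\<lambda>x. g x \<xi>) ` S)" and r: "f \<zeta> = ereal r"
    and active: "\<And>x. x \<in> S \<Longrightarrow> g x \<zeta> = f \<zeta> \<Longrightarrow> (dir_quotient (g x) \<zeta> d \<longlongrightarrow> L x) (at_right 0)"
    and inactive: "\<And>x. x \<in> S \<Longrightarrow> g x \<zeta> \<noteq> f \<zeta> \<Longrightarrow>
      \<exists>\<gamma>>r. \<forall>\<^sub>F t in at_right 0. ereal \<gamma> \<le> g x (\<zeta> + t *\<^sub>R d)"
  shows "(dir_quotient f \<zeta> d \<longlongrightarrow> Min (L ` {x \<in> S. g x \<zeta> = f \<zeta>})) (at_right 0)"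
proof -
  let ?T = "{x \<in> S. g x \<zeta> = f \<zeta>}"
  define h where "h x t = (g x (\<zeta> + t *\<^sub>R d) - ereal r) / ereal t" for x t
  define L' where "L' x = (if g x \<zeta> = f \<zeta> then L x else \<infinity>)" for x
  have "(h x \<longlongrightarrow> L' x) (at_right 0)" if x: "x \<in> S" for x
  proof (cases "g x \<zeta> = f \<zeta>")
    case True
    then have "h x = dir_quotient (g x) \<zeta> d" by (auto simp: h_def dir_quotient_def r)
    with active[OF x True] True show ?thesis by (simp add: L'_def)
  next
    case False
    then obtain \<gamma> where \<gamma>: "r < \<gamma>" "\<forall>\<^sub>F t in at_right 0. ereal \<gamma> \<le> g x (\<zeta> + t *\<^sub>R d)"
      using inactive[OF x] by blast
    from \<gamma>(2) eventually_at_right_less[of 0]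
    have ge: "\<forall>\<^sub>F t in at_right 0. ereal ((\<gamma> - r) / t) \<le> h x t"
    proof eventually_elim
      case (elim t)
      then show ?case unfolding h_def
        by (cases "g x (\<zeta> + t *\<^sub>R d)") (auto simp: divide_right_mono)
    qed
    have "((\<lambda>t. ereal ((\<gamma> - r) / t)) \<longlongrightarrow> \<infinity>) (at_right 0)"
      unfolding tendsto_PInfty_eq_at_top
      using filterlim_tendsto_pos_mult_at_top[OF tendsto_const, of "\<gamma> - r" inverse "at_right 0"]
        \<gamma>(1) filterlim_inverse_at_top_right by (simp add: divide_inverse)
    then have "(h x \<longlongrightarrow> \<infinity>) (at_right 0)"
      by (rule tendsto_sandwich[OF ge _ _ tendsto_const, rotated]) simp
    with False show ?thesis by (simp add: L'_def)
  qed
  from tendsto_Min[OF S this]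
  have "((\<lambda>t. Min ((\<lambda>x. h x t) ` S)) \<longlongrightarrow> Min (L' ` S)) (at_right 0)" .
  moreover have "\<forall>\<^sub>F t in at_right 0. Min ((\<lambda>x. h x t) ` S) = dir_quotient f \<zeta> d t"
    using eventually_at_right_less[of 0]
  proof eventually_elim
    case (elim t)
    have "mono (\<lambda>y. (y - ereal r) / ereal t)"
      using elim by (intro monoI ereal_divide_right_mono ereal_minus_mono) auto
    from mono_Min_commute[OF this, of "(\<lambda>x. g x (\<zeta> + t *\<^sub>R d)) ` S"] S show ?case
      by (simp add: dir_quotient_def r f[of "\<zeta> + t *\<^sub>R d"] h_def image_image)
  qed
  ultimately have "(dir_quotient f \<zeta> d \<longlongrightarrow> Min (L' ` S)) (at_right 0)"
    by (rule Lim_transform_eventually)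
  moreover have "Min (L' ` S) = Min (L ` ?T)"
  proof -
    have "f \<zeta> \<in> (\<lambda>x. g x \<zeta>) ` S" unfolding f[of \<zeta>] using S by (intro Min_in) auto
    then have T: "finite (L ` ?T)" "L ` ?T \<noteq> {}" using S by auto
    show ?thesis
    proof (rule Min_eqI)
      show "finite (L' ` S)" using S by simp
      show "Min (L ` ?T) \<le> y" if "y \<in> L' ` S" for y
        using that T by (auto simp: L'_def)
      show "Min (L ` ?T) \<in> L' ` S" using Min_in[OF T] by (auto simp: L'_def)
    qed
  qed
  ultimately show ?thesis by simp
qed

section \<open>The restricted value function as a finite minimum\<close>


lemma finite_bounded_natural_vectors:
  fixes X :: "(real^'k) set"
  assumes "bounded X" and nat: "\<And>x j. x \<in> X \<Longrightarrow> x $ j \<in> \<nat>"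
  shows "finite X"
proof -
  obtain B where B: "\<And>x. x \<in> X \<Longrightarrow> norm x \<le> B" using assms(1) by (auto simp: bounded_iff)
  define N where "N = nat \<lceil>B\<rceil>"
  have "(\<lambda>x j. x $ j) ` X \<subseteq> UNIV \<rightarrow>\<^sub>E real ` {..N}"
  proof (rule image_subsetI)
    fix x assume x: "x \<in> X"
    have "x $ j \<in> real ` {..N}" for j
    proof -
      obtain k where k: "x $ j = real k" using nat[OF x] by (auto elim: Nats_cases)
      have "real k \<le> B" using component_le_norm_cart[of x j] B[OF x] k by simp
      then have "k \<le> N" unfolding N_def by linarith
      with k show ?thesis by auto
    qed
    then show "(\<lambda>j. x $ j) \<in> UNIV \<rightarrow>\<^sub>E real ` {..N}" by auto
  qed
  moreover have "finite ((UNIV :: 'k set) \<rightarrow>\<^sub>E real ` {..N})" by (intro finite_PiE) auto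
  ultimately have "finite ((\<lambda>x j. x $ j) ` X)" by (rule finite_subset)
  then show ?thesis by (rule finite_imageD) (auto simp: inj_on_def vec_eq_iff fun_eq_iff)
qed

lemma finite_SI:
  assumes "bounded (X_MO P)" shows "finite (SI P)"
proof (rule finite_bounded_natural_vectors)
  have "SI P \<subseteq> fst ` X_MO P" by (force simp: SI_def SI_at_def feas_def)
  then show "bounded (SI P)" by (rule bounded_subset[OF bounded_fst[OF assms]])
  show "x $ j \<in> \<nat>" if "x \<in> SI P" for x j
    using that by (cases "j \<in> ints P") (auto simp: SI_def SI_at_def feas_def X_MO_def int_part_def)
qed

lemma SI_int_part: "xI \<in> SI P \<Longrightarrow> xI \<in> int_part P"
  by (auto simp: SI_def SI_at_def feas_def X_MO_def)

lemma bounded_continuous_fibre: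
  assumes "bounded (X_MO P)" "xI \<in> int_part P"
  shows "bounded {x \<in> cont_part P. Am P *v x = bv P - Am P *v xI}"
proof (rule bounded_subset[OF bounded_snd[OF assms(1)]])
  show "{x \<in> cont_part P. Am P *v x = bv P - Am P *v xI} \<subseteq> snd ` X_MO P"
    using assms(2) by (force simp: X_MO_def)
qed

lemma feas_iff_lp_feas:
  "xI \<in> int_part P \<Longrightarrow> (xI, xC) \<in> feas P \<zeta> \<longleftrightarrow> xC \<in> lp_feas P (\<zeta> - Cm P *v xI) (bv P - Am P *v xI)"
  by (auto simp: feas_def X_MO_def algebra_simps)

lemma zbar_le:
  assumes "(xI, xC) \<in> feas P \<zeta>"
  shows "zbar P xI \<zeta> \<le> ereal (c0 P \<bullet> xI + c0 P \<bullet> xC)"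
proof -
  have "xI \<in> int_part P" using assms by (simp add: feas_def X_MO_def)
  with assms have "z_LP P (\<zeta> - Cm P *v xI) (bv P - Am P *v xI) \<le> ereal (c0 P \<bullet> xC)"
    by (intro z_LP_le) (simp only: feas_iff_lp_feas)
  then show ?thesis unfolding zbar_def plus_ereal.simps(1)[symmetric] by (rule add_left_mono)
qed

lemma rvf_le_zbar:
  assumes "xI \<in> int_part P" shows "rvf P \<zeta> \<le> zbar P xI \<zeta>"
proof -
  have "rvf P \<zeta> - ereal (c0 P \<bullet> xI) \<le> z_LP P (\<zeta> - Cm P *v xI) (bv P - Am P *v xI)"
    unfolding z_LP_def
  proof (rule INF_greatest)
    fix xC assume "xC \<in> lp_feas P (\<zeta> - Cm P *v xI) (bv P - Am P *v xI)"
    then have "(xI, xC) \<in> feas P \<zeta>" using assms by (simp only: feas_iff_lp_feas)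
    then have "rvf P \<zeta> \<le> ereal (c0 P \<bullet> xI + c0 P \<bullet> xC)" unfolding rvf_def by (rule INF_lower2) simp
    then show "rvf P \<zeta> - ereal (c0 P \<bullet> xI) \<le> ereal (c0 P \<bullet> xC)"
      by (cases "rvf P \<zeta>") auto
  qed
  then show ?thesis unfolding zbar_def by (simp add: ereal_minus_le add.commute)
qed

text \<open>
  Valid at every right-hand side: where the problem is infeasible, the program of each integer part
  is infeasible too and both sides are \<open>\<infinity>\<close>. This matters because the derivative compares values at
  perturbed right-hand sides, which may leave the domain.
\<close>

lemma rvf_eq_Min_description:
  assumes desc: "is_description P S" and fin: "finite S" "S \<noteq> {}"
  shows "rvf P \<zeta> = Min ((\<lambda>xI. zbar P xI \<zeta>) ` S)"
proof (rule antisym)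
  have int: "xI \<in> int_part P" if "xI \<in> S" for xI
    using that desc by (auto simp: is_description_def intro: SI_int_part)
  then show "rvf P \<zeta> \<le> Min ((\<lambda>xI. zbar P xI \<zeta>) ` S)"
    using fin by (auto intro: rvf_le_zbar)
  show "Min ((\<lambda>xI. zbar P xI \<zeta>) ` S) \<le> rvf P \<zeta>"
  proof (cases "feas P \<zeta> = {}")
    case True
    then show ?thesis by (simp add: rvf_def top_ereal_def)
  next
    case False
    then have "\<zeta> \<in> feas_rhs P" by (simp add: feas_rhs_def)
    then obtain xI xC where "xI \<in> S" "(xI, xC) \<in> feas P \<zeta>"
      "ereal (c0 P \<bullet> xI + c0 P \<bullet> xC) = rvf P \<zeta>"
      using desc unfolding is_description_def by blast
    with zbar_le[of xI xC P \<zeta>] fin show ?thesis by (auto intro: Min.coboundedI order_trans)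
  qed
qed

section \<open>The directional derivative of the restricted value function\<close>


theorem proposition4:
  fixes P :: "('n::finite, 'm::finite, 'l::finite) momilp"
    and R :: "((real^'l) \<times> (real^'m)) set"
    and S_min :: "(real^'n) set"
    and \<zeta> d :: "real^'l"
  assumes "rational_data P"
    and "bounded (X_MO P)"
    and "ray_generators P R"
    and "is_minimal_description P S_min"
    and "\<zeta> \<in> feas_rhs P"
  shows "let T = SI_opt P \<zeta> \<inter> S_min in
    finite T \<and> T \<noteq> {} \<and>
    has_dir_deriv (rvf P) \<zeta> d \<and>
    (\<forall>xI\<in>T. has_dir_deriv (zbar P xI) \<zeta> d) \<and>
    (\<forall>xI\<in>T. dual_max_attained P xI \<zeta> d) \<and>
    dir_deriv (rvf P) \<zeta> d = Min ((\<lambda>xI. dir_deriv (zbar P xI) \<zeta> d) ` T) \<and>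
    Min ((\<lambda>xI. dir_deriv (zbar P xI) \<zeta> d) ` T) =
      (if d \<notin> (\<Inter>xI\<in>T. delta_minus P R xI \<zeta>)
       then Min ((\<lambda>xI. dual_max P xI \<zeta> d) ` T)
       else \<infinity>)"
proof -
  define T where "T = SI_opt P \<zeta> \<inter> S_min"
  have desc: "is_description P S_min" using assms(4) by (simp add: is_minimal_description_def)
  then have sub: "S_min \<subseteq> SI P" by (simp add: is_description_def)
  then have fin: "finite S_min" using finite_SI[OF assms(2)] by (rule finite_subset)
  have int: "xI \<in> int_part P" if "xI \<in> S_min" for xI using sub that by (auto intro: SI_int_part)
  have fibre: "bounded {x \<in> cont_part P. Am P *v x = bv P - Am P *v xI}" if "xI \<in> S_min" for xI
    using bounded_continuous_fibre[OF assms(2) int[OF that]] .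
  obtain xI xC where opt: "xI \<in> S_min" "(xI, xC) \<in> feas P \<zeta>"
    "ereal (c0 P \<bullet> xI + c0 P \<bullet> xC) = rvf P \<zeta>"
    using desc assms(5) unfolding is_description_def by blast
  define r where "r = c0 P \<bullet> xI + c0 P \<bullet> xC"
  have r: "rvf P \<zeta> = ereal r" using opt(3) by (simp add: r_def)
  have ne: "S_min \<noteq> {}" using opt(1) by auto
  have rvf: "rvf P \<xi> = Min ((\<lambda>xI. zbar P xI \<xi>) ` S_min)" for \<xi>
    by (rule rvf_eq_Min_description[OF desc fin ne])
  have T_feas: "\<exists>x. x \<in> lp_feas P (\<zeta> - Cm P *v xI) (bv P - Am P *v xI)"
    if "zbar P xI \<zeta> = rvf P \<zeta>" for xI
  proof (rule ccontr)
    assume "\<not> ?thesis"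
    then have empty: "lp_feas P (\<zeta> - Cm P *v xI) (bv P - Am P *v xI) = {}" by blast
    have "z_LP P (\<zeta> - Cm P *v xI) (bv P - Am P *v xI) = \<infinity>"
      unfolding z_LP_def empty by (simp add: top_ereal_def)
    then show False using that r by (simp add: zbar_def)
  qed
  have T_eq: "T = {xI \<in> S_min. zbar P xI \<zeta> = rvf P \<zeta>}"
  proof -
    have "xI \<in> SI_at P \<zeta>" if "xI \<in> S_min" "zbar P xI \<zeta> = rvf P \<zeta>" for xI
      using T_feas[OF that(2)] feas_iff_lp_feas[OF int[OF that(1)]] unfolding SI_at_def by blast
    then show ?thesis by (auto simp: T_def SI_opt_def)
  qed
  have T_fin: "finite T" using fin by (simp add: T_eq)
  have "zbar P xI \<zeta> = rvf P \<zeta>"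
    using zbar_le[OF opt(2)] rvf_le_zbar[OF int[OF opt(1)]] opt(3) by (intro antisym) simp_all
  then have T_ne: "T \<noteq> {}" using opt(1) by (auto simp: T_eq)
  have active: "(dir_quotient (zbar P xI) \<zeta> d \<longlongrightarrow> dual_max P xI \<zeta> d) (at_right 0)"
    "dual_max_attained P xI \<zeta> d" "dual_opt P xI \<zeta> \<noteq> {}"
    if "xI \<in> S_min" "zbar P xI \<zeta> = rvf P \<zeta>" for xI
    using T_feas[OF that(2)] dir_quotient_zbar[OF _ fibre[OF that(1)]] by blast+
  have inactive: "\<exists>\<gamma>>r. \<forall>\<^sub>F t in at_right 0. ereal \<gamma> \<le> zbar P xI (\<zeta> + t *\<^sub>R d)"
    if xI: "xI \<in> S_min" "zbar P xI \<zeta> \<noteq> rvf P \<zeta>" for xI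
  proof -
    let ?p = "\<zeta> - Cm P *v xI" and ?q = "bv P - Am P *v xI"
    have "ereal r < zbar P xI \<zeta>"
      using rvf_le_zbar[OF int[OF xI(1)], of \<zeta>] xI(2) r by simp
    then obtain \<gamma> where \<gamma>: "r < \<gamma>" "ereal \<gamma> < zbar P xI \<zeta>"
      using ereal_dense2[of "ereal r" "zbar P xI \<zeta>"] by (metis less_ereal.simps(1))
    then have "ereal (\<gamma> - c0 P \<bullet> xI) < z_LP P ?p ?q"
      unfolding zbar_def by (cases "z_LP P ?p ?q") auto
    from eventually_z_LP_ge[OF fibre[OF xI(1)] this, of d]
    have "\<forall>\<^sub>F t in at_right 0. ereal \<gamma> \<le> zbar P xI (\<zeta> + t *\<^sub>R d)"
    proof eventually_elim
      case (elim t)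
      have eq: "\<zeta> + t *\<^sub>R d - Cm P *v xI = ?p + t *\<^sub>R d" by simp
      show ?case using elim unfolding zbar_def eq
        by (cases "z_LP P (?p + t *\<^sub>R d) ?q") auto
    qed
    with \<gamma>(1) show ?thesis by blast
  qed
  have lim: "(dir_quotient (rvf P) \<zeta> d \<longlongrightarrow> Min ((\<lambda>xI. dual_max P xI \<zeta> d) ` T)) (at_right 0)"
    unfolding T_eq by (rule dir_quotient_Min[OF fin ne rvf r active(1) inactive])
  have deriv: "dir_deriv (zbar P xI) \<zeta> d = dual_max P xI \<zeta> d" if "xI \<in> T" for xI
    unfolding dir_deriv_def using that active(1) by (intro tendsto_Lim) (auto simp: T_eq)
  then have Min_eq: "Min ((\<lambda>xI. dir_deriv (zbar P xI) \<zeta> d) ` T) = Min ((\<lambda>xI. dual_max P xI \<zeta> d) ` T)"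
    by (simp cong: image_cong)
  have "Min ((\<lambda>xI. dual_max P xI \<zeta> d) ` T) = \<infinity>" if "d \<in> (\<Inter>xI\<in>T. delta_minus P R xI \<zeta>)"
  proof -
    have "dual_max P xI \<zeta> d = \<infinity>" if "xI \<in> T" for xI
      using that \<open>d \<in> _\<close> active(3) by (intro dual_max_eq_infinity[OF assms(3)]) (auto simp: T_eq)
    then have "(\<lambda>xI. dual_max P xI \<zeta> d) ` T = {\<infinity>}" using T_ne by auto
    then show ?thesis by simp
  qed
  moreover have "dir_deriv (rvf P) \<zeta> d = Min ((\<lambda>xI. dual_max P xI \<zeta> d) ` T)"
    unfolding dir_deriv_def using lim by (intro tendsto_Lim) simp_all
  ultimately show ?thesis
    using T_fin T_ne lim active(1,2) Min_eq
    unfolding Let_def T_def[symmetric] has_dir_deriv_def by (auto simp: T_eq)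
qed

end
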